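(* Let $\mathbf{r}=\mathbf{r}(\alpha,\beta)$ be a smooth surface in $\mathbb{R}^3$ in curvature line coordinates, with first fundamental form $A_1^2\,d\alpha^2+A_2^2\,d\beta^2$ ($A_1,A_2>0$) and principal curvatures $\kappa_1,\kappa_2$. Suppose that $(S_{A_1},S_{A_2},S_{\kappa_1},S_{\kappa_2})$ are symmetries of $(A_1,A_2,\kappa_1,\kappa_2)$, i.e. a smooth solution of the linearization (defined in the context) of the Gauss-Mainardi-Codazzi equations at $(A_1,A_2,\kappa_1,\kappa_2)$. Then the strains defined by $$\varepsilon_1=\frac{S_{A_1}}{A_1},\quad \varepsilon_2=\frac{S_{A_2}}{A_2},\quad k_1=S_{\kappa_1}+\frac{S_{A_1}}{A_1}\kappa_1,\quad k_2=S_{\kappa_2}+\frac{S_{A_2}}{A_2}\kappa_2$$ satisfy Gol'denweizer's compatibility condition for $\omega=\tau=0$, that is, $$P_\beta+Q_\alpha+H_\circ'K_\circ+H_\circ K_\circ'=0,\qquad (H_\circ')_\beta=PK_\circ+pK_\circ',\qquad (K_\circ')_\alpha=QH_\circ+qH_\circ',$$ where $$P=\frac{1}{A_2}\bigl((A_1\varepsilon_1)_\beta-\varepsilon_2(A_1)_\beta\bigr),\quad Q=\frac{1}{A_1}\bigl((A_2\varepsilon_2)_\alpha-\varepsilon_1(A_2)_\alpha\bigr),\quad H_\circ'=-k_1A_1,\quad K_\circ'=-k_2A_2 .$$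
   Context: Subscripts $\alpha,\beta$ denote partial derivatives; all functions are smooth on an open set of $(\alpha,\beta)$-plane. Notation for the surface: given $A_1,A_2,\kappa_1,\kappa_2$, put $$p=\frac{(A_1)_\beta}{A_2},\quad q=\frac{(A_2)_\alpha}{A_1},\quad H_\circ=-\kappa_1A_1,\quad K_\circ=-\kappa_2A_2 .$$ For a surface in curvature line coordinates (both fundamental forms diagonal), with unit normal $\mathbf{N}$ and $\mathbf{N}_\alpha=-\kappa_1\mathbf{r}_\alpha$, $\mathbf{N}_\beta=-\kappa_2\mathbf{r}_\beta$, these satisfy the Gauss-Mainardi-Codazzi equations $$p_\beta+q_\alpha+H_\circ K_\circ=0,\qquad (H_\circ)_\beta=pK_\circ,\qquad (K_\circ)_\alpha=qH_\circ .$$ Symmetries: a symmetry of a (nonlinear) differential equation is a solution of its linearized equation, obtained by replacing the unknown $f$ by $f+tS_f$ and requiring the equation to hold up to first order in $t$. Here $(S_{A_1},S_{A_2},S_{\kappa_1},S_{\kappa_2})$ are symmetries if, with the induced first variations $$S_p=\frac{(S_{A_1})_\beta-p\,S_{A_2}}{A_2},\quad S_q=\frac{(S_{A_2})_\alpha-q\,S_{A_1}}{A_1},\quad S_{H_\circ}=-(S_{\kappa_1}A_1+\kappa_1S_{A_1}),\quad S_{K_\circ}=-(S_{\kappa_2}A_2+\kappa_2S_{A_2}),$$ one has the linearized equations $$(S_p)_\beta+(S_q)_\alpha+S_{H_\circ}K_\circ+H_\circ S_{K_\circ}=0,\quad (S_{H_\circ})_\beta=S_pK_\circ+pS_{K_\circ},\quad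 (S_{K_\circ})_\alpha=S_qH_\circ+qS_{H_\circ}.$$ Terminology: $\varepsilon_1,\varepsilon_2$ are normal strains, $\omega$ the shear strain, $k_1,k_2$ the curvature changes and $\tau$ the twist of the middle surface of a thin shell; in the claim $\omega=\tau=0$. *)

theory Defs
  imports "HOL-Analysis.Analysis"
begin

text \<open>Functions of \<open>(\<alpha>, \<beta>)\<close> are total functions on \<open>real \<times> real\<close>; only their values on a given
  open set \<open>U\<close> matter.\<close>

definition D\<alpha> :: "(real \<times> real \<Rightarrow> 'a::real_normed_vector) \<Rightarrow> real \<times> real \<Rightarrow> 'a" where
  "D\<alpha> f x = vector_derivative (\<lambda>a. f (a, snd x)) (at (fst x))"

definition D\<beta> :: "(real \<times> real \<Rightarrow> 'a::real_normed_vector) \<Rightarrow> real \<times> real \<Rightarrow> 'a" where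
  "D\<beta> f x = vector_derivative (\<lambda>b. f (fst x, b)) (at (snd x))"

primrec Ck_on :: "nat \<Rightarrow> (real \<times> real \<Rightarrow> 'a::real_normed_vector) \<Rightarrow> (real \<times> real) set \<Rightarrow> bool" where
  "Ck_on 0 f U \<longleftrightarrow> continuous_on U f"
| "Ck_on (Suc n) f U \<longleftrightarrow>
     (\<forall>x\<in>U. f differentiable (at x)) \<and> Ck_on n (D\<alpha> f) U \<and> Ck_on n (D\<beta> f) U"

definition smooth_on :: "(real \<times> real \<Rightarrow> 'a::real_normed_vector) \<Rightarrow> (real \<times> real) set \<Rightarrow> bool" where
  "smooth_on f U \<longleftrightarrow> (\<forall>n. Ck_on n f U)"

text \<open>The choice between the two unit normals is left open. Given that both fundamental forms are
  diagonal, the principal curvatures are the factors in the Rodrigues equations, which also fixes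
  their sign relative to the normal.\<close>

definition curvature_line_surface ::
    "(real \<times> real) set \<Rightarrow> (real \<times> real \<Rightarrow> real^3) \<Rightarrow> (real \<times> real \<Rightarrow> real^3) \<Rightarrow>
     (real \<times> real \<Rightarrow> real) \<Rightarrow> (real \<times> real \<Rightarrow> real) \<Rightarrow>
     (real \<times> real \<Rightarrow> real) \<Rightarrow> (real \<times> real \<Rightarrow> real) \<Rightarrow> bool" where
  "curvature_line_surface U r N A1 A2 \<kappa>1 \<kappa>2 \<longleftrightarrow>
     open U \<and> smooth_on r U \<and> smooth_on N U \<and>
     smooth_on A1 U \<and> smooth_on A2 U \<and> smooth_on \<kappa>1 U \<and> smooth_on \<kappa>2 U \<and>
     (\<forall>x\<in>U.
        A1 x > 0 \<and> A2 x > 0 \<and>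
        D\<alpha> r x \<bullet> D\<alpha> r x = (A1 x)\<^sup>2 \<and> D\<alpha> r x \<bullet> D\<beta> r x = 0 \<and> D\<beta> r x \<bullet> D\<beta> r x = (A2 x)\<^sup>2 \<and>
        norm (N x) = 1 \<and> N x \<bullet> D\<alpha> r x = 0 \<and> N x \<bullet> D\<beta> r x = 0 \<and>
        D\<beta> (D\<alpha> r) x \<bullet> N x = 0 \<and>
        D\<alpha> N x = - \<kappa>1 x *\<^sub>R D\<alpha> r x \<and> D\<beta> N x = - \<kappa>2 x *\<^sub>R D\<beta> r x)"

definition p_of :: "(real \<times> real \<Rightarrow> real) \<Rightarrow> (real \<times> real \<Rightarrow> real) \<Rightarrow> real \<times> real \<Rightarrow> real" where
  "p_of A1 A2 x = D\<beta> A1 x / A2 x"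

definition q_of :: "(real \<times> real \<Rightarrow> real) \<Rightarrow> (real \<times> real \<Rightarrow> real) \<Rightarrow> real \<times> real \<Rightarrow> real" where
  "q_of A1 A2 x = D\<alpha> A2 x / A1 x"

text \<open>\<open>Ho_of A1 \<kappa>1\<close> is \<open>H\<^sub>\<circ>\<close> and \<open>Ho_of A2 \<kappa>2\<close> is \<open>K\<^sub>\<circ>\<close>.\<close>

definition Ho_of :: "(real \<times> real \<Rightarrow> real) \<Rightarrow> (real \<times> real \<Rightarrow> real) \<Rightarrow> real \<times> real \<Rightarrow> real" where
  "Ho_of A \<kappa> x = - (\<kappa> x * A x)"

text \<open>A symmetry is a smooth solution of the linearization at \<open>(A1, A2, \<kappa>1, \<kappa>2)\<close> of the
  Gauss-Mainardi-Codazzi equations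
  \<open>p\<^sub>\<beta> + q\<^sub>\<alpha> + H\<^sub>\<circ>K\<^sub>\<circ> = 0\<close>, \<open>(H\<^sub>\<circ>)\<^sub>\<beta> = p K\<^sub>\<circ>\<close>, \<open>(K\<^sub>\<circ>)\<^sub>\<alpha> = q H\<^sub>\<circ>\<close>,
  where \<open>Sp\<close>, \<open>Sq\<close>, \<open>SH\<close>, \<open>SK\<close> are the first variations of \<open>p\<close>, \<open>q\<close>, \<open>H\<^sub>\<circ>\<close>, \<open>K\<^sub>\<circ>\<close> induced by
  \<open>A1 + t SA1\<close>, \<open>A2 + t SA2\<close>, \<open>\<kappa>1 + t S\<kappa>1\<close>, \<open>\<kappa>2 + t S\<kappa>2\<close>.\<close>

definition GMC_symmetry ::
    "(real \<times> real) set \<Rightarrow>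
     (real \<times> real \<Rightarrow> real) \<Rightarrow> (real \<times> real \<Rightarrow> real) \<Rightarrow>
     (real \<times> real \<Rightarrow> real) \<Rightarrow> (real \<times> real \<Rightarrow> real) \<Rightarrow>
     (real \<times> real \<Rightarrow> real) \<Rightarrow> (real \<times> real \<Rightarrow> real) \<Rightarrow>
     (real \<times> real \<Rightarrow> real) \<Rightarrow> (real \<times> real \<Rightarrow> real) \<Rightarrow> bool" where
  "GMC_symmetry U A1 A2 \<kappa>1 \<kappa>2 SA1 SA2 S\<kappa>1 S\<kappa>2 \<longleftrightarrow>
     smooth_on SA1 U \<and> smooth_on SA2 U \<and> smooth_on S\<kappa>1 U \<and> smooth_on S\<kappa>2 U \<and>
     (let p = p_of A1 A2; q = q_of A1 A2; H = Ho_of A1 \<kappa>1; K = Ho_of A2 \<kappa>2;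
          Sp = (\<lambda>x. (D\<beta> SA1 x - p x * SA2 x) / A2 x);
          Sq = (\<lambda>x. (D\<alpha> SA2 x - q x * SA1 x) / A1 x);
          SH = (\<lambda>x. - (S\<kappa>1 x * A1 x + \<kappa>1 x * SA1 x));
          SK = (\<lambda>x. - (S\<kappa>2 x * A2 x + \<kappa>2 x * SA2 x))
      in \<forall>x\<in>U.
           D\<beta> Sp x + D\<alpha> Sq x + SH x * K x + H x * SK x = 0 \<and>
           D\<beta> SH x = Sp x * K x + p x * SK x \<and>
           D\<alpha> SK x = Sq x * H x + q x * SH x)"

text \<open>Gol'denweizer's compatibility condition for vanishing shear strain and twist.\<close>

definition goldenweizer_compatible ::
    "(real \<times> real) set \<Rightarrow>
     (real \<times> real \<Rightarrow> real) \<Rightarrow> (real \<times> real \<Rightarrow> real) \<Rightarrow>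
     (real \<times> real \<Rightarrow> real) \<Rightarrow> (real \<times> real \<Rightarrow> real) \<Rightarrow>
     (real \<times> real \<Rightarrow> real) \<Rightarrow> (real \<times> real \<Rightarrow> real) \<Rightarrow>
     (real \<times> real \<Rightarrow> real) \<Rightarrow> (real \<times> real \<Rightarrow> real) \<Rightarrow> bool" where
  "goldenweizer_compatible U A1 A2 \<kappa>1 \<kappa>2 \<epsilon>1 \<epsilon>2 k1 k2 \<longleftrightarrow>
     (let p = p_of A1 A2; q = q_of A1 A2; H = Ho_of A1 \<kappa>1; K = Ho_of A2 \<kappa>2;
          P = (\<lambda>x. 1 / A2 x * (D\<beta> (\<lambda>y. A1 y * \<epsilon>1 y) x - \<epsilon>2 x * D\<beta> A1 x));
          Q = (\<lambda>x. 1 / A1 x * (D\<alpha> (\<lambda>y. A2 y * \<epsilon>2 y) x - \<epsilon>1 x * D\<alpha> A2 x));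
          H' = (\<lambda>x. - (k1 x * A1 x));
          K' = (\<lambda>x. - (k2 x * A2 x))
      in \<forall>x\<in>U.
           D\<beta> P x + D\<alpha> Q x + H' x * K x + H x * K' x = 0 \<and>
           D\<beta> H' x = P x * K x + p x * K' x \<and>
           D\<alpha> K' x = Q x * H x + q x * H' x)"

end

theory Submission
  imports Defs
begin

text \<open>Pointwise on \<open>U\<close>, Gol'denweizer's \<open>P\<close>, \<open>Q\<close>, \<open>H\<^sub>\<circ>'\<close>, \<open>K\<^sub>\<circ>'\<close> are exactly the first variations of
  \<open>p\<close>, \<open>q\<close>, \<open>H\<^sub>\<circ>\<close>, \<open>K\<^sub>\<circ>\<close>, so the compatibility condition is the linearized system itself.\<close>

text \<open>A partial derivative is local: since \<open>U\<close> is open, the line of constant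
  \<beta> through \<open>x\<close> stays in \<open>U\<close> near \<open>x\<close>. This lets
  identities known only on \<open>U\<close> be differentiated, although the functions are
  total.\<close>

lemma D\<alpha>_cong_open:
  assumes "open U" "x \<in> U" and eq: "\<And>y. y \<in> U \<Longrightarrow> f y = g y"
  shows "D\<alpha> f x = D\<alpha> g x"
proof -
  have "((\<lambda>a. (a, snd x)) \<longlongrightarrow> (fst x, snd x)) (nhds (fst x))"
    by (intro tendsto_intros filterlim_ident)
  then have "\<forall>\<^sub>F a in nhds (fst x). (a, snd x) \<in> U"
    by (rule topological_tendstoD) (use assms in auto)
  \<comment> \<open>The vacuous premise \<open>a \<in> UNIV\<close> matches
    \<open>vector_derivative_cong_eq\<close>, which concerns derivatives within a set.\<close>
  then have "\<forall>\<^sub>F a in nhds (fst x). a \<in> UNIV \<longrightarrow> f (a, snd x) = g (a, snd x)"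
    by eventually_elim (simp add: eq)
  then show ?thesis
    unfolding D\<alpha>_def by (rule vector_derivative_cong_eq) auto
qed

lemma D\<beta>_cong_open:
  assumes "open U" "x \<in> U" and eq: "\<And>y. y \<in> U \<Longrightarrow> f y = g y"
  shows "D\<beta> f x = D\<beta> g x"
proof -
  have "((\<lambda>b. (fst x, b)) \<longlongrightarrow> (fst x, snd x)) (nhds (snd x))"
    by (intro tendsto_intros filterlim_ident)
  then have "\<forall>\<^sub>F b in nhds (snd x). (fst x, b) \<in> U"
    by (rule topological_tendstoD) (use assms in auto)
  then have "\<forall>\<^sub>F b in nhds (snd x). b \<in> UNIV \<longrightarrow> f (fst x, b) = g (fst x, b)"
    by eventually_elim (simp add: eq)
  then show ?thesis
    unfolding D\<beta>_def by (rule vector_derivative_cong_eq) auto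
qed

theorem theorem7p1:
  fixes U :: "(real \<times> real) set"
    and r N :: "real \<times> real \<Rightarrow> real^3"
    and A1 A2 \<kappa>1 \<kappa>2 SA1 SA2 S\<kappa>1 S\<kappa>2 \<epsilon>1 \<epsilon>2 k1 k2 :: "real \<times> real \<Rightarrow> real"
  assumes "curvature_line_surface U r N A1 A2 \<kappa>1 \<kappa>2"
    and "GMC_symmetry U A1 A2 \<kappa>1 \<kappa>2 SA1 SA2 S\<kappa>1 S\<kappa>2"
    and "\<forall>x\<in>U. \<epsilon>1 x = SA1 x / A1 x"
    and "\<forall>x\<in>U. \<epsilon>2 x = SA2 x / A2 x"
    and "\<forall>x\<in>U. k1 x = S\<kappa>1 x + SA1 x / A1 x * \<kappa>1 x"
    and "\<forall>x\<in>U. k2 x = S\<kappa>2 x + SA2 x / A2 x * \<kappa>2 x"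
  shows "goldenweizer_compatible U A1 A2 \<kappa>1 \<kappa>2 \<epsilon>1 \<epsilon>2 k1 k2"
proof -
  have U: "open U" and pos: "\<And>x. x \<in> U \<Longrightarrow> A1 x > 0 \<and> A2 x > 0"
    using assms(1) by (auto simp: curvature_line_surface_def)
  define P where "P = (\<lambda>x. 1 / A2 x * (D\<beta> (\<lambda>y. A1 y * \<epsilon>1 y) x - \<epsilon>2 x * D\<beta> A1 x))"
  define Q where "Q = (\<lambda>x. 1 / A1 x * (D\<alpha> (\<lambda>y. A2 y * \<epsilon>2 y) x - \<epsilon>1 x * D\<alpha> A2 x))"
  define H' where "H' = (\<lambda>x. - (k1 x * A1 x))"
  define K' where "K' = (\<lambda>x. - (k2 x * A2 x))"
  define Sp where "Sp = (\<lambda>x. (D\<beta> SA1 x - p_of A1 A2 x * SA2 x) / A2 x)"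
  define Sq where "Sq = (\<lambda>x. (D\<alpha> SA2 x - q_of A1 A2 x * SA1 x) / A1 x)"
  define SH where "SH = (\<lambda>x. - (S\<kappa>1 x * A1 x + \<kappa>1 x * SA1 x))"
  define SK where "SK = (\<lambda>x. - (S\<kappa>2 x * A2 x + \<kappa>2 x * SA2 x))"
  have P: "P x = Sp x" if "x \<in> U" for x
  proof -
    \<comment> \<open>As \<open>A1\<close> is positive on \<open>U\<close>,
      \<open>A1 * \<epsilon>1\<close> is \<open>SA1\<close> there. In the other term,
      \<open>\<epsilon>2 * D\<beta> A1\<close> regroups as \<open>p * SA2\<close>, because both have
      the quotient by \<open>A2\<close>.\<close>
    have "D\<beta> (\<lambda>y. A1 y * \<epsilon>1 y) x = D\<beta> SA1 x"
      using pos assms(3) by (intro D\<beta>_cong_open[OF U that]) force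
    then show ?thesis
      using assms(4) that by (simp add: P_def Sp_def p_of_def)
  qed
  have Q: "Q x = Sq x" if "x \<in> U" for x
  proof -
    have "D\<alpha> (\<lambda>y. A2 y * \<epsilon>2 y) x = D\<alpha> SA2 x"
      using pos assms(4) by (intro D\<alpha>_cong_open[OF U that]) force
    then show ?thesis
      using assms(3) that by (simp add: Q_def Sq_def q_of_def)
  qed
  \<comment> \<open>Multiplying \<open>k1\<close> by \<open>A1\<close> cancels the denominator in
    its strain term and leaves the product rule for \<kappa>1 times \<open>A1\<close>.\<close>
  have H': "H' x = SH x" if "x \<in> U" for x
    using assms(5) that pos[OF that] by (simp add: H'_def SH_def field_simps)
  have K': "K' x = SK x" if "x \<in> U" for x
    using assms(6) that pos[OF that] by (simp add: K'_def SK_def field_simps)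
  have derivs: "D\<beta> P x = D\<beta> Sp x" "D\<alpha> Q x = D\<alpha> Sq x" "D\<beta> H' x = D\<beta> SH x" "D\<alpha> K' x = D\<alpha> SK x"
    if "x \<in> U" for x
    using P Q H' K' by (auto intro!: D\<alpha>_cong_open[OF U that] D\<beta>_cong_open[OF U that])
  show ?thesis
    using assms(2)
    \<comment> \<open>Folding exposes the differentiated functions by name, so \<open>derivs\<close>
      can rewrite them. Expanding \<open>Sp\<close> and \<open>Sq\<close> then brings goal and
      hypothesis to the same form.\<close>
    unfolding goldenweizer_compatible_def GMC_symmetry_def Let_def
      P_def[symmetric] Q_def[symmetric] H'_def[symmetric] K'_def[symmetric]
      Sp_def[symmetric] Sq_def[symmetric] SH_def[symmetric] SK_def[symmetric]
    by (simp add: P Q H' K' derivs Sp_def Sq_def)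
qed

end
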